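(* Let $\alpha\in(0,1]$, let $\theta>0$, and set $\tau(\mu):=(1+\mu)\theta$ for $\mu>0$. Then $$\lim_{\mu\to\infty}\mathcal{X}_{ss}^{\mu,\tau(\mu)}(\alpha)=\mathcal{X}(\alpha),$$ where the limit of sets is in the Painlevé–Kuratowski sense.
   Context: $(\Omega,\mathcal{F},\mathbb{P})$ is a probability space and $\Xi:\Omega\to\mathbb{R}^d$ is a random vector. $\mathcal{X}=\{x\in\mathbb{R}^n : g(x)\ge 0\}$ is nonempty and compact, with $g:\mathbb{R}^n\to\mathbb{R}^m$ twice differentiable. The scalar function $f(x,\xi)$, $x\in\mathbb{R}^n$, $\xi\in\mathbb{R}^d$, is real-valued and twice continuously differentiable. $Z(x):=f(x,\Xi)$, with cumulative distribution function $F_{Z(x)}(t)=\mathbb{P}(Z(x)\le t)$. The feasible set of the chance-constrained problem is $\mathcal{X}(\alpha):=\{x\in\mathcal{X} : \mathbb{P}(f(x,\Xi)\le 0)\ge 1-\alpha\}$, assumed compact for all $\alpha\in(0,1]$. Write $[a]_+:=\max\{a,0\}$ and, for $\mu,\tau>0$, $\psi_{ss}^{\mu,\tau}(z):=\left[2\,\frac{1+\mu}{\mu+e^{-\tau z}}-1\right]_+$. Define $$\text{SigVaR}_{1-\alpha}^{\mu,\tau}(Z):=\inf\{t\in\mathbb{R} : \mathbb{E}[\psi_{ss}^{\mu,\tau}(Z-t)]\le\alpha\}.$$ The feasible set of the SigVaR approximation is $$\mathcal{X}_{ss}^{\mu,\tau}(\alpha):=\{x\in\mathcal{X} : \text{SigVaR}_{1-\alpha}^{\mu,\tau}(f(x,\Xi))\le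 0\},$$ equivalently $\{x\in\mathcal{X} : \mathbb{E}[\psi_{ss}^{\mu,\tau}(f(x,\Xi))]\le\alpha\}$. Standing assumptions: (i) there exists $\kappa>0$ such that, for every $x\in\mathcal{X}$, $F_{Z(x)}(t)$ is Lipschitz continuous in $t\in[-\kappa,\kappa]$; (ii) $\mathcal{X}(\alpha)=\mathrm{cl}\,\mathcal{X}^I(\alpha)$, where $\mathcal{X}^I(\alpha):=\{x\in\mathcal{X} : \mathbb{P}(f(x,\Xi)>0)<\alpha\}$ and $\mathrm{cl}$ denotes closure. *)

theory Defs
  imports "HOL-Probability.Probability"
begin

text \<open>
  Twice differentiability on a whole normed space. The derivative is taken as a map into the
  bounded linear functions, so that it can be differentiated (and be continuous) in operator norm.
\<close>

definition twice_differentiable :: "('a::real_normed_vector \<Rightarrow> 'b::real_normed_vector) \<Rightarrow> bool" where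
  "twice_differentiable h \<longleftrightarrow>
     (\<exists>D :: 'a \<Rightarrow> ('a \<Rightarrow>\<^sub>L 'b).
        (\<forall>x. (h has_derivative blinfun_apply (D x)) (at x)) \<and>
        (\<forall>x. D differentiable (at x)))"

definition twice_continuously_differentiable ::
    "('a::real_normed_vector \<Rightarrow> 'b::real_normed_vector) \<Rightarrow> bool" where
  "twice_continuously_differentiable h \<longleftrightarrow>
     (\<exists>(D :: 'a \<Rightarrow> ('a \<Rightarrow>\<^sub>L 'b)) (D2 :: 'a \<Rightarrow> ('a \<Rightarrow>\<^sub>L ('a \<Rightarrow>\<^sub>L 'b))).
        (\<forall>x. (h has_derivative blinfun_apply (D x)) (at x)) \<and>
        (\<forall>x. (D has_derivative blinfun_apply (D2 x)) (at x)) \<and>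
        continuous_on UNIV D2)"

text \<open>
  Painleve--Kuratowski limits of a family of sets \<open>C s\<close> as \<open>s\<close> tends along the filter \<open>F\<close>, in the
  sequential form of Rockafellar and Wets, Variational Analysis, Section 5.B.
  Only the tails of the sequences matter.
\<close>

definition PK_outer_limit :: "('s \<Rightarrow> 'a::topological_space set) \<Rightarrow> 's filter \<Rightarrow> 'a set" where
  "PK_outer_limit C F =
     {x. \<exists>(s :: nat \<Rightarrow> 's) (u :: nat \<Rightarrow> 'a).
           filterlim s F sequentially \<and> (\<forall>k. u k \<in> C (s k)) \<and> u \<longlonglongrightarrow> x}"

definition PK_inner_limit :: "('s \<Rightarrow> 'a::topological_space set) \<Rightarrow> 's filter \<Rightarrow> 'a set" where
  "PK_inner_limit C F =
     {x. \<forall>s :: nat \<Rightarrow> 's. filterlim s F sequentially \<longrightarrow>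
           (\<exists>u :: nat \<Rightarrow> 'a. (\<forall>\<^sub>F k in sequentially. u k \<in> C (s k)) \<and> u \<longlonglongrightarrow> x)}"

definition PK_converges :: "('s \<Rightarrow> 'a::topological_space set) \<Rightarrow> 'a set \<Rightarrow> 's filter \<Rightarrow> bool" where
  "PK_converges C A F \<longleftrightarrow> PK_inner_limit C F = A \<and> PK_outer_limit C F = A"

definition deterministic_set :: "(real ^ 'n \<Rightarrow> real ^ 'm) \<Rightarrow> (real ^ 'n) set" where
  "deterministic_set g = {x. \<forall>i. 0 \<le> g x $ i}"

definition chance_feasible ::
    "'w measure \<Rightarrow> ('w \<Rightarrow> real ^ 'd) \<Rightarrow> (real ^ 'n \<Rightarrow> real ^ 'd \<Rightarrow> real) \<Rightarrow>
     (real ^ 'n \<Rightarrow> real ^ 'm) \<Rightarrow> real \<Rightarrow> (real ^ 'n) set" where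
  "chance_feasible M \<Xi> f g \<alpha> =
     {x \<in> deterministic_set g. \<P>(\<omega> in M. f x (\<Xi> \<omega>) \<le> 0) \<ge> 1 - \<alpha>}"

definition strict_chance_feasible ::
    "'w measure \<Rightarrow> ('w \<Rightarrow> real ^ 'd) \<Rightarrow> (real ^ 'n \<Rightarrow> real ^ 'd \<Rightarrow> real) \<Rightarrow>
     (real ^ 'n \<Rightarrow> real ^ 'm) \<Rightarrow> real \<Rightarrow> (real ^ 'n) set" where
  "strict_chance_feasible M \<Xi> f g \<alpha> =
     {x \<in> deterministic_set g. \<P>(\<omega> in M. f x (\<Xi> \<omega>) > 0) < \<alpha>}"

definition psi_ss :: "real \<Rightarrow> real \<Rightarrow> real \<Rightarrow> real" where
  "psi_ss \<mu> \<tau> z = max (2 * ((1 + \<mu>) / (\<mu> + exp (- \<tau> * z))) - 1) 0"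

text \<open>
  The sigmoidal value-at-risk at level \<open>1 - \<alpha>\<close>. For a random variable \<open>Z\<close> on a probability space,
  \<open>\<mu>, \<tau> > 0\<close> and \<open>0 < \<alpha> \<le> 1\<close>, the integrand is bounded and measurable, and the expectation tends
  to \<open>0\<close> as \<open>t\<close> tends to infinity and to \<open>1 + 2 / \<mu> > \<alpha>\<close> as \<open>t\<close> tends to minus infinity. So the set
  is nonempty and bounded below, and the infimum in the reals is the genuine one.
\<close>

definition SigVaR :: "'w measure \<Rightarrow> real \<Rightarrow> real \<Rightarrow> real \<Rightarrow> ('w \<Rightarrow> real) \<Rightarrow> real" where
  "SigVaR M \<mu> \<tau> \<alpha> Z = Inf {t. (\<integral>\<omega>. psi_ss \<mu> \<tau> (Z \<omega> - t) \<partial>M) \<le> \<alpha>}"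

definition SigVaR_feasible ::
    "'w measure \<Rightarrow> ('w \<Rightarrow> real ^ 'd) \<Rightarrow> (real ^ 'n \<Rightarrow> real ^ 'd \<Rightarrow> real) \<Rightarrow>
     (real ^ 'n \<Rightarrow> real ^ 'm) \<Rightarrow> real \<Rightarrow> real \<Rightarrow> real \<Rightarrow> (real ^ 'n) set" where
  "SigVaR_feasible M \<Xi> f g \<mu> \<tau> \<alpha> =
     {x \<in> deterministic_set g. SigVaR M \<mu> \<tau> \<alpha> (\<lambda>\<omega>. f x (\<Xi> \<omega>)) \<le> 0}"

end

theory Submission
  imports Defs "HOL-Real_Asymp.Real_Asymp"
begin

text \<open>
  For \<open>\<mu> > 0\<close> the function \<open>psi_ss\<close> is monotone, takes the value \<open>1\<close> at \<open>0\<close>, and therefore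
  dominates the indicator of \<open>[0, \<infinity>)\<close>. Its expectation bounds the probability of a violated constraint,
  so every approximating set is contained in the chance-constrained set.

  With \<open>\<tau> = (1 + \<mu>) \<theta>\<close> the term \<open>exp (- \<tau> z)\<close> beats \<open>\<mu>\<close> for every \<open>z < 0\<close>, so \<open>psi_ss\<close> converges
  pointwise to that indicator (lemma \<open>psi_ss_tendsto_indicator\<close>). By dominated convergence the
  expectation converges to \<open>\<P>(Z \<ge> 0)\<close>, which is \<open>\<P>(Z > 0)\<close> because the distribution function
  of \<open>Z\<close> is continuous at \<open>0\<close>. A point with \<open>\<P>(Z > 0) < \<alpha>\<close> hence belongs to all approximating sets
  with \<open>\<mu>\<close> large.

  The approximating sets thus lie between a set that they eventually absorb pointwise and the closure
  of this set, and such a squeeze forces Painleve--Kuratowski convergence to the closure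
  (lemma \<open>PK_converges_closureI\<close>). The passage between the quantile form \<open>SigVaR \<le> 0\<close> and the
  expectation form is lemma \<open>SigVaR_le_0_iff\<close>.
\<close>

section \<open>Painleve--Kuratowski limits of squeezed families\<close>

text \<open>
  The squeeze principle. A recovery sequence for \<open>x \<in> closure A\<close> is formed by almost nearest points:
  the distance from \<open>x\<close> to \<open>C (s k)\<close> tends to \<open>0\<close> because points of \<open>A\<close> arbitrarily near \<open>x\<close> are
  eventually in \<open>C (s k)\<close>. The sequence \<open>s0\<close> makes the inner limit a subset of the outer one, which
  would fail for a filter along which no sequence tends.
\<close>

lemma PK_converges_closureI:
  fixes C :: "'s \<Rightarrow> 'a::metric_space set"
  assumes s0: "filterlim s0 F sequentially"
    and upper: "\<forall>\<^sub>F s in F. C s \<subseteq> closure A"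
    and lower: "\<And>x. x \<in> A \<Longrightarrow> \<forall>\<^sub>F s in F. x \<in> C s"
  shows "PK_converges C (closure A) F"
proof -
  have outer: "PK_outer_limit C F \<subseteq> closure A"
  proof
    fix x assume "x \<in> PK_outer_limit C F"
    then obtain s u where su: "filterlim s F sequentially" "\<And>k. u k \<in> C (s k)" "u \<longlonglongrightarrow> x"
      by (auto simp: PK_outer_limit_def)
    have "\<forall>\<^sub>F k in sequentially. C (s k) \<subseteq> closure A"
      by (rule eventually_compose_filterlim[OF upper su(1)])
    hence "\<forall>\<^sub>F k in sequentially. u k \<in> closure A"
      by eventually_elim (use su(2) in blast)
    thus "x \<in> closure A"
      using su(3) by (intro Lim_in_closed_set[of "closure A" u sequentially]) auto
  qed
  have inner: "closure A \<subseteq> PK_inner_limit C F"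
  proof
    fix x assume x: "x \<in> closure A"
    show "x \<in> PK_inner_limit C F"
      unfolding PK_inner_limit_def
    proof (intro CollectI allI impI)
      fix s :: "nat \<Rightarrow> 's" assume s: "filterlim s F sequentially"
      have near: "\<forall>\<^sub>F k in sequentially. C (s k) \<noteq> {} \<and> infdist x (C (s k)) < e" if e: "e > 0" for e
      proof -
        obtain y where y: "y \<in> A" "dist y x < e"
          using x e unfolding closure_approachable by blast
        have "\<forall>\<^sub>F k in sequentially. y \<in> C (s k)"
          by (rule eventually_compose_filterlim[OF lower[OF y(1)] s])
        thus ?thesis
        proof eventually_elim
          case (elim k)
          have "infdist x (C (s k)) \<le> dist x y" by (rule infdist_le[OF elim])
          thus ?case using elim y(2) by (auto simp: dist_commute)
        qed
      qed
      have "\<exists>v. C (s k) \<noteq> {} \<longrightarrow> v \<in> C (s k) \<and> dist x v < infdist x (C (s k)) + 1 / real (Suc k)" for k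
      proof (cases "C (s k) = {}")
        case False
        show ?thesis
        proof (rule ccontr)
          assume "\<not> ?thesis"
          hence "\<And>v. v \<in> C (s k) \<Longrightarrow> infdist x (C (s k)) + 1 / real (Suc k) \<le> dist x v"
            by (auto simp: not_less)
          hence "infdist x (C (s k)) + 1 / real (Suc k) \<le> infdist x (C (s k))"
            unfolding infdist_notempty[OF False] by (intro cINF_greatest False)
          thus False by simp
        qed
      qed auto
      then obtain u where u: "\<And>k. C (s k) \<noteq> {} \<Longrightarrow>
          u k \<in> C (s k) \<and> dist x (u k) < infdist x (C (s k)) + 1 / real (Suc k)"
        by metis
      have "u \<longlonglongrightarrow> x"
      proof (rule tendstoI)
        fix e :: real assume e: "e > 0"
        have "(\<lambda>k. 1 / real (Suc k)) \<longlonglongrightarrow> 0" by real_asymp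
        hence "\<forall>\<^sub>F k in sequentially. 1 / real (Suc k) < e / 2"
          by (rule order_tendstoD(2)) (use e in simp)
        moreover have "\<forall>\<^sub>F k in sequentially. C (s k) \<noteq> {} \<and> infdist x (C (s k)) < e / 2"
          using near[of "e / 2"] e by simp
        ultimately show "\<forall>\<^sub>F k in sequentially. dist (u k) x < e"
        proof eventually_elim
          case (elim k)
          have "dist x (u k) < infdist x (C (s k)) + 1 / real (Suc k)" using u elim by blast
          thus ?case using elim by (simp only: dist_commute[of "u k" x]) linarith
        qed
      qed
      moreover have "\<forall>\<^sub>F k in sequentially. u k \<in> C (s k)"
        using near[of 1, simplified] by eventually_elim (use u in blast)
      ultimately show "\<exists>u. (\<forall>\<^sub>F k in sequentially. u k \<in> C (s k)) \<and> u \<longlonglongrightarrow> x" by blast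
    qed
  qed
  have "PK_inner_limit C F \<subseteq> PK_outer_limit C F"
  proof
    fix x assume "x \<in> PK_inner_limit C F"
    then obtain u where u: "\<forall>\<^sub>F k in sequentially. u k \<in> C (s0 k)" "u \<longlonglongrightarrow> x"
      using s0 by (auto simp: PK_inner_limit_def)
    then obtain N where N: "\<And>k. k \<ge> N \<Longrightarrow> u k \<in> C (s0 k)"
      by (auto simp: eventually_sequentially)
    have shift: "filterlim (\<lambda>k. k + N) sequentially sequentially"
      by (rule filterlim_add_const_nat_at_top)
    have "filterlim (\<lambda>k. s0 (k + N)) F sequentially" "(\<lambda>k. u (k + N)) \<longlonglongrightarrow> x"
      using filterlim_compose[OF s0 shift] filterlim_compose[OF u(2) shift] by auto
    moreover have "\<forall>k. u (k + N) \<in> C (s0 (k + N))" using N by auto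
    ultimately show "x \<in> PK_outer_limit C F"
      unfolding PK_outer_limit_def
      by (intro CollectI exI[of _ "\<lambda>k. s0 (k + N)"] exI[of _ "\<lambda>k. u (k + N)"]) auto
  qed
  thus ?thesis using inner outer by (auto simp: PK_converges_def)
qed

section \<open>The sigmoidal function\<close>

lemma psi_ss_nonneg: "0 \<le> psi_ss \<mu> \<tau> z"
  by (simp add: psi_ss_def)

lemma psi_ss_le:
  assumes "\<mu> > 0"
  shows "psi_ss \<mu> \<tau> z \<le> 1 + 2 / \<mu>"
proof -
  have "(1 + \<mu>) / (\<mu> + exp (- \<tau> * z)) \<le> (1 + \<mu>) / \<mu>"
    using assms by (intro divide_left_mono) (auto intro!: mult_pos_pos add_pos_pos)
  also have "\<dots> = 1 + 1 / \<mu>" using assms by (simp add: field_simps)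
  finally have "2 * ((1 + \<mu>) / (\<mu> + exp (- \<tau> * z))) - 1 \<le> 2 * (1 + 1 / \<mu>) - 1"
    by (intro diff_right_mono mult_left_mono) auto
  also have "\<dots> = 1 + 2 / \<mu>" by simp
  finally show ?thesis using assms unfolding psi_ss_def by (intro max.boundedI) auto
qed

lemma psi_ss_mono:
  assumes "\<mu> > 0" "\<tau> > 0" "y \<le> z"
  shows "psi_ss \<mu> \<tau> y \<le> psi_ss \<mu> \<tau> z"
proof -
  have "(1 + \<mu>) / (\<mu> + exp (- \<tau> * y)) \<le> (1 + \<mu>) / (\<mu> + exp (- \<tau> * z))"
    using assms by (intro divide_left_mono) (auto intro!: mult_pos_pos add_pos_pos)
  thus ?thesis unfolding psi_ss_def by (intro max.mono) linarith+
qed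

lemma psi_ss_0: "\<mu> > 0 \<Longrightarrow> psi_ss \<mu> \<tau> 0 = 1"
  by (simp add: psi_ss_def field_simps)

lemma indicator_le_psi_ss:
  assumes "\<mu> > 0" "\<tau> > 0"
  shows "indicator {0..} z \<le> psi_ss \<mu> \<tau> z"
  using psi_ss_mono[OF assms, of 0 z] psi_ss_0[OF assms(1)] psi_ss_nonneg
  by (auto simp: indicator_def)

lemma continuous_psi_ss:
  assumes "\<mu> > 0"
  shows "continuous_on UNIV (psi_ss \<mu> \<tau>)"
proof -
  have "\<mu> + exp (- \<tau> * z) \<noteq> 0" for z using assms by (metis add_pos_pos exp_gt_zero less_irrefl)
  thus ?thesis unfolding psi_ss_def by (intro continuous_intros) auto
qed

lemma psi_ss_tendsto_at_top:
  assumes "\<mu> > 0" "\<tau> > 0"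
  shows "((\<lambda>s. psi_ss \<mu> \<tau> (z + s)) \<longlongrightarrow> 1 + 2 / \<mu>) at_top"
proof -
  have "((\<lambda>s. 2 * ((1 + \<mu>) / (\<mu> + exp (- \<tau> * (z + s)))) - 1) \<longlongrightarrow> 2 * ((1 + \<mu>) / \<mu>) - 1) at_top"
    using assms by (real_asymp simp: field_simps)
  hence "((\<lambda>s. psi_ss \<mu> \<tau> (z + s)) \<longlongrightarrow> max (2 * ((1 + \<mu>) / \<mu>) - 1) 0) at_top"
    unfolding psi_ss_def by (intro tendsto_max tendsto_const)
  also have "max (2 * ((1 + \<mu>) / \<mu>) - 1) 0 = 1 + 2 / \<mu>"
    using assms by (simp add: field_simps)
  finally show ?thesis .
qed

lemma psi_ss_tendsto_at_bot:
  assumes "\<mu> > 0" "\<tau> > 0"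
  shows "((\<lambda>s. psi_ss \<mu> \<tau> (z - s)) \<longlongrightarrow> 0) at_top"
proof -
  have "((\<lambda>s. 2 * ((1 + \<mu>) / (\<mu> + exp (- \<tau> * (z - s)))) - 1) \<longlongrightarrow> -1) at_top"
    using assms by real_asymp
  hence "((\<lambda>s. psi_ss \<mu> \<tau> (z - s)) \<longlongrightarrow> max (-1) 0) at_top"
    unfolding psi_ss_def by (intro tendsto_max tendsto_const)
  thus ?thesis by simp
qed

text \<open>
  Here the coupling of \<open>\<tau>\<close> to \<open>\<mu>\<close> enters. For \<open>z < 0\<close> the positive part vanishes as soon as
  \<open>exp (- \<tau> z) \<ge> \<mu> + 2\<close>. This fails for large \<open>\<mu>\<close> if \<open>\<tau>\<close> is fixed, but \<open>\<tau> = (1 + \<mu>) \<theta>\<close> makes the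
  exponential outgrow \<open>\<mu>\<close>. At the jump \<open>z = 0\<close> the value is \<open>1\<close> for every \<open>\<mu> > 0\<close>.
\<close>

lemma psi_ss_tendsto_indicator:
  assumes "\<theta> > 0"
  shows "((\<lambda>\<mu>. psi_ss \<mu> ((1 + \<mu>) * \<theta>) z) \<longlongrightarrow> indicator {0..} z) at_top"
proof -
  consider "z = 0" | "z > 0" | "z < 0" by linarith
  thus ?thesis
  proof cases
    case 1
    have "\<forall>\<^sub>F \<mu> in at_top. psi_ss \<mu> ((1 + \<mu>) * \<theta>) z = 1"
      using eventually_gt_at_top[of 0] by eventually_elim (simp add: 1 psi_ss_0)
    thus ?thesis using 1 by (simp add: tendsto_eventually)
  next
    case 2
    define c where "c = \<theta> * z"
    have "c > 0" using 2 assms by (simp add: c_def)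
    hence "((\<lambda>\<mu>. 2 * ((1 + \<mu>) / (\<mu> + exp (- ((1 + \<mu>) * c)))) - 1) \<longlongrightarrow> 1) at_top"
      by real_asymp
    hence "((\<lambda>\<mu>. max (2 * ((1 + \<mu>) / (\<mu> + exp (- ((1 + \<mu>) * c)))) - 1) 0) \<longlongrightarrow> max 1 0) at_top"
      by (intro tendsto_max tendsto_const)
    thus ?thesis using 2 by (simp add: psi_ss_def c_def mult.assoc)
  next
    case 3
    define c where "c = - (\<theta> * z)"
    have "c > 0" using 3 assms by (simp add: c_def mult_pos_neg)
    hence "((\<lambda>\<mu>. 2 * ((1 + \<mu>) / (\<mu> + exp ((1 + \<mu>) * c))) - 1) \<longlongrightarrow> -1) at_top"
      by real_asymp
    hence "((\<lambda>\<mu>. max (2 * ((1 + \<mu>) / (\<mu> + exp ((1 + \<mu>) * c))) - 1) 0) \<longlongrightarrow> max (-1) 0) at_top"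
      by (intro tendsto_max tendsto_const)
    thus ?thesis using 3 by (simp add: psi_ss_def c_def mult.assoc)
  qed
qed

section \<open>Expectations of the sigmoidal function\<close>

lemma borel_measurable_psi_ss [measurable (raw)]:
  assumes "Z \<in> borel_measurable M"
  shows "(\<lambda>\<omega>. psi_ss \<mu> \<tau> (Z \<omega>)) \<in> borel_measurable M"
  unfolding psi_ss_def using assms by measurable

lemma (in prob_space) integrable_psi_ss:
  assumes "\<mu> > 0" "Z \<in> borel_measurable M"
  shows "integrable M (\<lambda>\<omega>. psi_ss \<mu> \<tau> (Z \<omega>))"
  using assms psi_ss_le[OF assms(1)] psi_ss_nonneg
  by (intro integrable_const_bound[where B = "1 + 2 / \<mu>"]) auto

text \<open>
  The set in the definition of \<open>SigVaR\<close> is upward closed because \<open>psi_ss\<close> is monotone, and it is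
  topologically closed by dominated convergence. The bounds \<open>0 < \<alpha>\<close> and \<open>\<alpha> \<le> 1 < 1 + 2 / \<mu>\<close> make it
  nonempty and bounded below, so it is the half-line starting at its infimum.
\<close>

lemma (in prob_space) SigVaR_le_0_iff:
  assumes \<mu>: "\<mu> > 0" and \<tau>: "\<tau> > 0" and \<alpha>: "0 < \<alpha>" "\<alpha> \<le> 1"
    and Z [measurable]: "Z \<in> borel_measurable M"
  shows "SigVaR M \<mu> \<tau> \<alpha> Z \<le> 0 \<longleftrightarrow> (\<integral>\<omega>. psi_ss \<mu> \<tau> (Z \<omega>) \<partial>M) \<le> \<alpha>"
proof -
  define E where "E t = (\<integral>\<omega>. psi_ss \<mu> \<tau> (Z \<omega> - t) \<partial>M)" for t
  define S where "S = {t. E t \<le> \<alpha>}"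
  have bound: "\<bar>psi_ss \<mu> \<tau> z\<bar> \<le> 1 + 2 / \<mu>" for z
    using psi_ss_le[OF \<mu>] psi_ss_nonneg by simp
  have mono: "E t' \<le> E t" if "t \<le> t'" for t t'
    unfolding E_def using that
    by (intro integral_mono integrable_psi_ss psi_ss_mono \<mu> \<tau>) auto
  have "((\<lambda>s. E (- s)) \<longlongrightarrow> (\<integral>\<omega>. 1 + 2 / \<mu> \<partial>M)) at_top"
    unfolding E_def
    by (rule integral_dominated_convergence_at_top[where w = "\<lambda>_. 1 + 2 / \<mu>"])
       (use bound psi_ss_tendsto_at_top[OF \<mu> \<tau>] in auto)
  hence lim: "((\<lambda>s. E (- s)) \<longlongrightarrow> 1 + 2 / \<mu>) at_top" by (simp add: prob_space)
  have "1 + 2 / \<mu> > \<alpha>" using \<alpha> \<mu> by (intro le_less_trans[OF \<alpha>(2)]) simp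
  hence "\<forall>\<^sub>F s in at_top. \<alpha> < E (- s)" by (rule order_tendstoD(1)[OF lim])
  then obtain s0 where s0: "\<And>s. s \<ge> s0 \<Longrightarrow> \<alpha> < E (- s)"
    by (auto simp: eventually_at_top_linorder)
  have bdd: "bdd_below S"
  proof (rule bdd_belowI)
    fix t assume "t \<in> S"
    thus "- s0 \<le> t" using s0[of "- t"] by (force simp: S_def)
  qed
  have "(E \<longlongrightarrow> (\<integral>\<omega>. 0 \<partial>M)) at_top"
    unfolding E_def
    by (rule integral_dominated_convergence_at_top[where w = "\<lambda>_. 1 + 2 / \<mu>"])
       (use bound psi_ss_tendsto_at_bot[OF \<mu> \<tau>] in auto)
  hence "\<forall>\<^sub>F t in at_top. E t < \<alpha>" using order_tendstoD(2)[of E 0 at_top \<alpha>] \<alpha> by simp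
  then obtain t0 where "E t0 < \<alpha>" by (auto simp: eventually_at_top_linorder)
  hence ne: "S \<noteq> {}" by (auto simp: S_def intro!: exI[of _ t0])
  have "closed S"
    unfolding closed_sequential_limits
  proof (intro allI impI, elim conjE)
    fix t l assume t: "\<forall>n. t n \<in> S" "t \<longlonglongrightarrow> l"
    have "(\<lambda>n. E (t n)) \<longlonglongrightarrow> E l"
      unfolding E_def
    proof (rule integral_dominated_convergence[where w = "\<lambda>_. 1 + 2 / \<mu>"])
      show "AE \<omega> in M. (\<lambda>n. psi_ss \<mu> \<tau> (Z \<omega> - t n)) \<longlonglongrightarrow> psi_ss \<mu> \<tau> (Z \<omega> - l)"
        by (intro AE_I2 continuous_on_tendsto_compose[OF continuous_psi_ss[OF \<mu>]] tendsto_intros t)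
           auto
    qed (use bound in auto)
    moreover have "\<forall>n. E (t n) \<le> \<alpha>" using t(1) by (simp add: S_def)
    ultimately have "E l \<le> \<alpha>" by (intro LIMSEQ_le_const2) auto
    thus "l \<in> S" by (simp add: S_def)
  qed
  hence Inf: "Inf S \<in> S" by (rule closed_contains_Inf[OF ne bdd])
  have "Inf S \<le> 0 \<longleftrightarrow> 0 \<in> S"
  proof
    assume "Inf S \<le> 0"
    thus "0 \<in> S" using Inf mono[of "Inf S" 0] by (simp add: S_def)
  next
    assume "0 \<in> S"
    thus "Inf S \<le> 0" using bdd by (rule cInf_lower)
  qed
  moreover have "SigVaR M \<mu> \<tau> \<alpha> Z = Inf S" by (simp add: SigVaR_def S_def E_def)
  moreover have "0 \<in> S \<longleftrightarrow> (\<integral>\<omega>. psi_ss \<mu> \<tau> (Z \<omega>) \<partial>M) \<le> \<alpha>" by (simp add: S_def E_def)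
  ultimately show ?thesis by simp
qed

text \<open>A Markov-type bound, by integrating \<open>indicator_le_psi_ss\<close>.\<close>

lemma (in prob_space) prob_nonneg_le_expectation_psi_ss:
  assumes "\<mu> > 0" "\<tau> > 0" and Z [measurable]: "Z \<in> borel_measurable M"
  shows "\<P>(\<omega> in M. 0 \<le> Z \<omega>) \<le> (\<integral>\<omega>. psi_ss \<mu> \<tau> (Z \<omega>) \<partial>M)"
proof -
  have "\<P>(\<omega> in M. 0 \<le> Z \<omega>) = (\<integral>\<omega>. indicator {\<omega> \<in> space M. 0 \<le> Z \<omega>} \<omega> \<partial>M)"
    by simp
  also have "\<dots> \<le> (\<integral>\<omega>. psi_ss \<mu> \<tau> (Z \<omega>) \<partial>M)"
  proof (rule integral_mono)
    show "indicator {\<omega> \<in> space M. 0 \<le> Z \<omega>} \<omega> \<le> psi_ss \<mu> \<tau> (Z \<omega>)" if "\<omega> \<in> space M" for \<omega>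
      using indicator_le_psi_ss[OF assms(1,2), of "Z \<omega>"] that by (simp add: indicator_def)
    show "integrable M (indicat_real {\<omega> \<in> space M. 0 \<le> Z \<omega>})"
      by (rule integrable_const_bound[where B = 1]) auto
  qed (auto intro!: integrable_psi_ss assms)
  finally show ?thesis .
qed

lemma (in prob_space) expectation_psi_ss_tendsto_prob_nonneg:
  assumes "\<theta> > 0" and Z [measurable]: "Z \<in> borel_measurable M"
  shows "((\<lambda>\<mu>. \<integral>\<omega>. psi_ss \<mu> ((1 + \<mu>) * \<theta>) (Z \<omega>) \<partial>M) \<longlongrightarrow> \<P>(\<omega> in M. 0 \<le> Z \<omega>)) at_top"
proof -
  have "((\<lambda>\<mu>. \<integral>\<omega>. psi_ss \<mu> ((1 + \<mu>) * \<theta>) (Z \<omega>) \<partial>M)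
      \<longlongrightarrow> (\<integral>\<omega>. indicator {\<omega> \<in> space M. 0 \<le> Z \<omega>} \<omega> \<partial>M)) at_top"
  proof (rule integral_dominated_convergence_at_top[where w = "\<lambda>_. 3"])
    (* For \<mu> \<ge> 1 the supremum 1 + 2 / \<mu> of psi_ss is at most 3. *)
    show "\<forall>\<^sub>F \<mu> in at_top. AE \<omega> in M. norm (psi_ss \<mu> ((1 + \<mu>) * \<theta>) (Z \<omega>)) \<le> 3"
      using eventually_ge_at_top[of 1]
    proof eventually_elim
      case (elim \<mu>)
      have "psi_ss \<mu> ((1 + \<mu>) * \<theta>) z \<le> 3" for z
      proof (rule order_trans[OF psi_ss_le])
        show "1 + 2 / \<mu> \<le> 3" using elim by (simp add: field_simps)
      qed (use elim in simp)
      thus ?case using psi_ss_nonneg by simp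
    qed
    show "AE \<omega> in M. ((\<lambda>\<mu>. psi_ss \<mu> ((1 + \<mu>) * \<theta>) (Z \<omega>))
        \<longlongrightarrow> indicator {\<omega> \<in> space M. 0 \<le> Z \<omega>} \<omega>) at_top"
    proof (rule AE_I2)
      fix \<omega> assume "\<omega> \<in> space M"
      thus "((\<lambda>\<mu>. psi_ss \<mu> ((1 + \<mu>) * \<theta>) (Z \<omega>))
          \<longlongrightarrow> indicator {\<omega> \<in> space M. 0 \<le> Z \<omega>} \<omega>) at_top"
        using psi_ss_tendsto_indicator[OF assms(1), of "Z \<omega>"] by (simp add: indicator_def)
    qed
  qed auto
  thus ?thesis by simp
qed

text \<open>The jump of a distribution function at a point is the mass of that point.\<close>

lemma (in prob_space) prob_nonneg_eq_prob_pos: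
  assumes Z [measurable]: "Z \<in> borel_measurable M"
    and cont: "isCont (cdf (distr M borel Z)) 0"
  shows "\<P>(\<omega> in M. 0 \<le> Z \<omega>) = \<P>(\<omega> in M. 0 < Z \<omega>)"
proof -
  interpret D: real_distribution "distr M borel Z" by simp
  have "measure (distr M borel Z) {0} = 0" using cont by (simp add: D.isCont_cdf)
  hence "\<P>(\<omega> in M. Z \<omega> = 0) = 0"
    by (simp add: measure_distr vimage_def Int_def conj_commute)
  moreover have "\<P>(\<omega> in M. 0 \<le> Z \<omega>) = \<P>(\<omega> in M. 0 < Z \<omega>) + \<P>(\<omega> in M. Z \<omega> = 0)"
    by (subst finite_measure_Union[symmetric]) (auto intro!: arg_cong[where f = prob])
  ultimately show ?thesis by simp
qed

section \<open>Convergence of the feasible sets\<close>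

theorem theorem2:
  fixes M :: "'w measure"
    and \<Xi> :: "'w \<Rightarrow> real ^ 'd"
    and f :: "real ^ 'n \<Rightarrow> real ^ 'd \<Rightarrow> real"
    and g :: "real ^ 'n \<Rightarrow> real ^ 'm"
    and \<alpha> \<theta> :: real
  assumes "prob_space M"
    and "\<Xi> \<in> borel_measurable M"
    and "twice_differentiable g"
    and "twice_continuously_differentiable (\<lambda>(x, \<xi>). f x \<xi>)"
    and "deterministic_set g \<noteq> {}"
    and "compact (deterministic_set g)"
    and "\<And>\<beta>. \<beta> \<in> {0<..1} \<Longrightarrow> compact (chance_feasible M \<Xi> f g \<beta>)"
    and "\<exists>\<kappa>>0. \<forall>x\<in>deterministic_set g. \<exists>L.
           L-lipschitz_on {-\<kappa>..\<kappa>} (cdf (distr M borel (\<lambda>\<omega>. f x (\<Xi> \<omega>))))"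
    and "chance_feasible M \<Xi> f g \<alpha> = closure (strict_chance_feasible M \<Xi> f g \<alpha>)"
    and "\<alpha> \<in> {0<..1}"
    and "\<theta> > 0"
  shows "PK_converges (\<lambda>\<mu>. SigVaR_feasible M \<Xi> f g \<mu> ((1 + \<mu>) * \<theta>) \<alpha>)
           (chance_feasible M \<Xi> f g \<alpha>) at_top"
proof -
  interpret prob_space M by fact
  define Z where "Z = (\<lambda>x \<omega>. f x (\<Xi> \<omega>))"
  define X where "X = deterministic_set g"
  obtain D where D: "\<And>p. ((\<lambda>(x, \<xi>). f x \<xi>) has_derivative blinfun_apply (D p)) (at p)"
    using assms(4) unfolding twice_continuously_differentiable_def by blast
  have "continuous_on UNIV (\<lambda>(x, \<xi>). f x \<xi>)"
    by (intro continuous_at_imp_continuous_on ballI has_derivative_continuous[OF D])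
  hence "continuous_on UNIV (\<lambda>\<xi>. (\<lambda>(x, \<xi>). f x \<xi>) (x, \<xi>))" for x
    by (rule continuous_on_compose2) (auto intro!: continuous_intros)
  hence "f x \<in> borel_measurable borel" for x
    by (intro borel_measurable_continuous_onI) simp
  hence Z [measurable]: "Z x \<in> borel_measurable M" for x
    unfolding Z_def using assms(2) by measurable
  have \<alpha>: "0 < \<alpha>" "\<alpha> \<le> 1" using assms(10) by auto
  let ?C = "\<lambda>\<mu>. SigVaR_feasible M \<Xi> f g \<mu> ((1 + \<mu>) * \<theta>) \<alpha>"
  have C: "x \<in> ?C \<mu> \<longleftrightarrow> x \<in> X \<and> (\<integral>\<omega>. psi_ss \<mu> ((1 + \<mu>) * \<theta>) (Z x \<omega>) \<partial>M) \<le> \<alpha>" if "\<mu> > 0" for x \<mu>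
    using SigVaR_le_0_iff[OF that _ \<alpha> Z, of "(1 + \<mu>) * \<theta>" x] that assms(11)
    by (simp add: SigVaR_feasible_def X_def Z_def)
  have upper: "?C \<mu> \<subseteq> chance_feasible M \<Xi> f g \<alpha>" if "\<mu> > 0" for \<mu>
  proof
    fix x assume "x \<in> ?C \<mu>"
    hence x: "x \<in> X" "(\<integral>\<omega>. psi_ss \<mu> ((1 + \<mu>) * \<theta>) (Z x \<omega>) \<partial>M) \<le> \<alpha>"
      using C[OF that] by auto
    have "\<P>(\<omega> in M. 0 < Z x \<omega>) \<le> \<P>(\<omega> in M. 0 \<le> Z x \<omega>)"
      by (rule finite_measure_mono) auto
    also have "\<dots> \<le> \<alpha>"
      using prob_nonneg_le_expectation_psi_ss[OF that _ Z, of "(1 + \<mu>) * \<theta>" x] x(2) that assms(11)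
      by simp
    finally have "\<P>(\<omega> in M. 0 < Z x \<omega>) \<le> \<alpha>" .
    moreover have "\<P>(\<omega> in M. \<not> Z x \<omega> \<le> 0) = 1 - \<P>(\<omega> in M. Z x \<omega> \<le> 0)"
      by (rule prob_neg) measurable
    ultimately show "x \<in> chance_feasible M \<Xi> f g \<alpha>"
      using x(1) by (simp add: chance_feasible_def X_def Z_def not_le)
  qed
  have lower: "\<forall>\<^sub>F \<mu> in at_top. x \<in> ?C \<mu>" if "x \<in> strict_chance_feasible M \<Xi> f g \<alpha>" for x
  proof -
    have x: "x \<in> X" "\<P>(\<omega> in M. 0 < Z x \<omega>) < \<alpha>"
      using that by (auto simp: strict_chance_feasible_def X_def Z_def)
    obtain \<kappa> L where \<kappa>: "\<kappa> > 0" "L-lipschitz_on {-\<kappa>..\<kappa>} (cdf (distr M borel (Z x)))"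
      using assms(8) x(1) unfolding X_def Z_def by blast
    have "isCont (cdf (distr M borel (Z x))) 0"
      using lipschitz_on_continuous_on[OF \<kappa>(2)] \<kappa>(1)
      by (intro continuous_on_interior[of "{-\<kappa>..\<kappa>}"]) (auto simp: interior_atLeastAtMost_real)
    hence "\<P>(\<omega> in M. 0 \<le> Z x \<omega>) < \<alpha>" using prob_nonneg_eq_prob_pos[OF Z] x(2) by simp
    hence "\<forall>\<^sub>F \<mu> in at_top. (\<integral>\<omega>. psi_ss \<mu> ((1 + \<mu>) * \<theta>) (Z x \<omega>) \<partial>M) < \<alpha>"
      by (rule order_tendstoD(2)[OF expectation_psi_ss_tendsto_prob_nonneg[OF assms(11) Z]])
    thus ?thesis
      using eventually_gt_at_top[of 0] by eventually_elim (simp add: C x(1))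
  qed
  show ?thesis
    unfolding assms(9)
  proof (rule PK_converges_closureI[OF filterlim_real_sequentially])
    show "\<forall>\<^sub>F \<mu> in at_top. ?C \<mu> \<subseteq> closure (strict_chance_feasible M \<Xi> f g \<alpha>)"
      using eventually_gt_at_top[of 0] by eventually_elim (use upper assms(9) in simp)
  qed (rule lower)
qed

end
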